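(* Let $A=S\Lambda S^{-1}\in\mathbb{C}^{d\times d}$ be diagonalizable by a known eigenvector basis $S$, with $\Lambda$ the diagonal matrix of eigenvalues $\lambda_0,\dots,\lambda_{d-1}$, and assume that the eigenvalues are absolutely collision-free. Let $\{\phi_i\}_{i=0}^{J-1}\subset\mathbb{C}^d$ allow parameter identification and phase retrieval, and let $y:=S^*x$ be elementwise non-zero for the unknown signal $x\in\mathbb{C}^d$. Then the eigenvalues of $A$ and the unknown signal $x$ are identifiable with $\mathcal O(d)$ spatiotemporal samples.
   Context: Spatiotemporal samples are the phaseless values $|\langle x,A^\ell\phi_i\rangle|$ with $\ell\in\{0,1,2,\dots\}$ and $i\in\{0,\dots,J-1\}$, where $\langle\cdot,\cdot\rangle$ is the standard inner product on $\mathbb{C}^d$; identifiable means determined up to global phase. The count $\mathcal O(d)$ is understood as follows: with $L_i:=\#[\operatorname{supp}(S^{-1}\phi_i)]$ and $L:=\max_i L_i$, the number of samples used is bounded by $2L^2J$. At most $d$ sampling vectors are needed to build a set allowing parameter identification and phase retrieval, for instance with $\operatorname{supp}(S^{-1}\phi_i)=\{i,\dots,i+L-1\}$ for $i=0,\dots,d-L$ and $L\ge3$. This gives $\mathcal O(dL^2)$ samples, which is linear in $d$ for a fixed sparsity $L$. $S^*$ is the conjugate transpose; $\operatorname{supp}$ is the set of indices of non-zero components. Complex numbers $\mu_0,\dots,\mu_{d-1}$ are collision-free if the products $\mu_j\overline{\mu_k}$, $j,k\in\{0,\dots,d-1\}$, are pairwise distinct; they are absolutely collision-free if, in addition, the products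 $|\mu_j||\mu_k|$ for $j>k$ are pairwise distinct. With $\psi_i:=S^{-1}\phi_i$ (components $\psi_{i,k}$), the set $\{\phi_i\}_{i=0}^{J-1}$ allows parameter identification and phase retrieval if the following three properties hold. (i) Index separation: $\bigcup_{i=0}^{J-1}\operatorname{supp}\psi_i=\{0,\dots,d-1\}$, and for every $k\in\{0,\dots,d-1\}$ there exist two index sets $\mathcal F_k,\mathcal G_k$ with $\{k\}=\bigcap_{i\in\mathcal F_k}\operatorname{supp}\psi_i\setminus\bigcup_{i\in\mathcal G_k}\operatorname{supp}\psi_i$. (ii) Phase propagation: the set is ordered such that $\#\bigl[\operatorname{supp}\psi_k\cap\bigcup_{i=0}^{k-1}\operatorname{supp}\psi_i\bigr]\ge2$ for $k=1,\dots,J-1$. (iii) Winding direction determination: there are indices $i_1,i_2,k_1,k_2$ such that $\psi_{i_1,k_1}\overline{\psi_{i_1,k_2}}$ and $\psi_{i_2,k_1}\overline{\psi_{i_2,k_2}}$ are non-zero and $\arg(\psi_{i_1,k_1}\overline{\psi_{i_1,k_2}})\not\equiv\arg(\psi_{i_2,k_1}\overline{\psi_{i_2,k_2}})\pmod\pi$. *)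

theory Defs
  imports "Jordan_Normal_Form.Schur_Decomposition" "HOL-Library.Real_Mod"
begin

definition supp :: "complex vec \<Rightarrow> nat set" where
  "supp v = {k. k < dim_vec v \<and> v $ k \<noteq> 0}"

definition collision_free :: "nat \<Rightarrow> (nat \<Rightarrow> complex) \<Rightarrow> bool" where
  "collision_free d \<mu> \<longleftrightarrow> inj_on (\<lambda>(j, k). \<mu> j * cnj (\<mu> k)) ({..<d} \<times> {..<d})"

definition absolutely_collision_free :: "nat \<Rightarrow> (nat \<Rightarrow> complex) \<Rightarrow> bool" where
  "absolutely_collision_free d \<mu> \<longleftrightarrow>
     collision_free d \<mu> \<and>
     inj_on (\<lambda>(j, k). cmod (\<mu> j) * cmod (\<mu> k)) {(j, k). k < j \<and> j < d}"

text \<open>The following conditions concern the coefficient vectors \<open>\<psi> i = S\<^sup>-\<^sup>1 \<phi> i\<close> for \<open>i < J\<close>.\<close>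

(* An empty F is useless here, since its intersection is the infinite set UNIV. Reading the
   empty intersection as {..<d} instead gives an equivalent condition: by the covering
   property, an empty F could then be replaced by {i} for some i with k in supp (psi i). *)
definition index_separation :: "nat \<Rightarrow> nat \<Rightarrow> (nat \<Rightarrow> complex vec) \<Rightarrow> bool" where
  "index_separation d J \<psi> \<longleftrightarrow>
     (\<Union>i<J. supp (\<psi> i)) = {..<d} \<and>
     (\<forall>k<d. \<exists>F G. F \<subseteq> {..<J} \<and> G \<subseteq> {..<J} \<and>
        {k} = (\<Inter>i\<in>F. supp (\<psi> i)) - (\<Union>i\<in>G. supp (\<psi> i)))"

definition phase_propagation :: "nat \<Rightarrow> (nat \<Rightarrow> complex vec) \<Rightarrow> bool" where
  "phase_propagation J \<psi> \<longleftrightarrow>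
     (\<forall>k. 1 \<le> k \<and> k < J \<longrightarrow> 2 \<le> card (supp (\<psi> k) \<inter> (\<Union>i<k. supp (\<psi> i))))"

definition winding_direction :: "nat \<Rightarrow> nat \<Rightarrow> (nat \<Rightarrow> complex vec) \<Rightarrow> bool" where
  "winding_direction d J \<psi> \<longleftrightarrow>
     (\<exists>i1<J. \<exists>i2<J. \<exists>k1<d. \<exists>k2<d.
        \<psi> i1 $ k1 * cnj (\<psi> i1 $ k2) \<noteq> 0 \<and>
        \<psi> i2 $ k1 * cnj (\<psi> i2 $ k2) \<noteq> 0 \<and>
        \<not> [Arg (\<psi> i1 $ k1 * cnj (\<psi> i1 $ k2)) = Arg (\<psi> i2 $ k1 * cnj (\<psi> i2 $ k2))] (rmod pi))"

text \<open>The argument \<open>Sinv\<close> below stands for the inverse of the eigenvector basis.\<close>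

definition allows_identification ::
    "nat \<Rightarrow> complex mat \<Rightarrow> nat \<Rightarrow> (nat \<Rightarrow> complex vec) \<Rightarrow> bool" where
  "allows_identification d Sinv J \<phi> \<longleftrightarrow>
     index_separation d J (\<lambda>i. Sinv *\<^sub>v \<phi> i) \<and>
     phase_propagation J (\<lambda>i. Sinv *\<^sub>v \<phi> i) \<and>
     winding_direction d J (\<lambda>i. Sinv *\<^sub>v \<phi> i)"

definition max_sparsity :: "complex mat \<Rightarrow> nat \<Rightarrow> (nat \<Rightarrow> complex vec) \<Rightarrow> nat" where
  "max_sparsity Sinv J \<phi> = Max ((\<lambda>i. card (supp (Sinv *\<^sub>v \<phi> i))) ` {..<J})"

definition st_sample ::
    "complex mat \<Rightarrow> (nat \<Rightarrow> complex vec) \<Rightarrow> complex vec \<Rightarrow> nat \<times> nat \<Rightarrow> real" where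
  "st_sample A \<phi> x = (\<lambda>(i, l). cmod (x \<bullet>c ((A ^\<^sub>m l) *\<^sub>v \<phi> i)))"

(* Multiplying all eigenvalues by one unimodular constant changes no sample, so the eigenvalues,
   like the signal, can be determined only up to a global phase. The competitors mu and z
   are arbitrary; only S and the sampling vectors are known a priori. *)
definition identifiable_from ::
    "nat \<Rightarrow> complex mat \<Rightarrow> complex mat \<Rightarrow> (nat \<Rightarrow> complex vec) \<Rightarrow> (nat \<times> nat) set
      \<Rightarrow> (nat \<Rightarrow> complex) \<Rightarrow> complex vec \<Rightarrow> bool" where
  "identifiable_from d S Sinv \<phi> \<Omega> \<Lambda> x \<longleftrightarrow>
     (\<forall>\<mu> z. z \<in> carrier_vec d \<longrightarrow>
        (\<forall>\<omega>\<in>\<Omega>. st_sample (S * mat_diag d \<mu> * Sinv) \<phi> z \<omega> =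
               st_sample (S * mat_diag d \<Lambda> * Sinv) \<phi> x \<omega>) \<longrightarrow>
        (\<exists>c. cmod c = 1 \<and> (\<forall>j<d. \<mu> j = c * \<Lambda> j)) \<and>
        (\<exists>c. cmod c = 1 \<and> z = c \<cdot>\<^sub>v x))"

end

theory Submission
  imports Defs
begin

text \<open>The squared samples of one sampling vector are moments of an atomic measure with atoms
  \<open>\<lambda>\<^sub>j cnj \<lambda>\<^sub>k\<close>, where \<open>j, k\<close> range over the support of \<open>\<psi>\<^sub>i\<close>. As in Prony's method, \<open>2 L\<^sup>2\<close> moments
  determine a measure with at most \<open>L\<^sup>2\<close> atoms. Its real atoms are the squared moduli of the
  eigenvalues on the support. Matching the moduli of the true and the competing eigenvalues thus
  yields a permutation of the indices that preserves every support, and index separation forces it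
  to be the identity. Absolute freeness of collisions then
  fixes each product \<open>\<lambda>\<^sub>j cnj \<lambda>\<^sub>k\<close> up to conjugation. The choice of conjugation is the same for all
  pairs in a support (by the cocycle identity), propagates through overlaps of two indices, and is
  decided by the winding direction. The coefficients at the atoms finally give the signal.\<close>

subsection \<open>Uniqueness of exponential sums\<close>

lemma sum_poly_eq_zero:
  fixes b :: "complex \<Rightarrow> complex" and p :: "complex poly"
  assumes mom: "\<And>l. l < n \<Longrightarrow> (\<Sum>x\<in>X. b x * x ^ l) = 0" and deg: "degree p < n"
  shows "(\<Sum>x\<in>X. b x * poly p x) = 0"
proof -
  have "(\<Sum>x\<in>X. b x * poly p x) = (\<Sum>x\<in>X. \<Sum>l\<le>degree p. coeff p l * (b x * x ^ l))"
    by (simp add: poly_altdef sum_distrib_left mult_ac)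
  also have "\<dots> = (\<Sum>l\<le>degree p. coeff p l * (\<Sum>x\<in>X. b x * x ^ l))"
    by (subst sum.swap) (simp add: sum_distrib_left)
  also have "\<dots> = 0"
    using mom deg by (intro sum.neutral) auto
  finally show ?thesis .
qed

text \<open>A Vandermonde argument: testing the moments against the polynomial that vanishes at
  every other node isolates the weight at \<open>x\<close>.\<close>

lemma vanishing_moments_imp_zero:
  fixes b :: "complex \<Rightarrow> complex"
  assumes fin: "finite X" and mom: "\<And>l. l < card X \<Longrightarrow> (\<Sum>x\<in>X. b x * x ^ l) = 0" and xX: "x \<in> X"
  shows "b x = 0"
proof -
  define p :: "complex poly" where "p = (\<Prod>y\<in>X - {x}. [:- y, 1:])"
  have "degree p = card (X - {x})"
    unfolding p_def by (subst degree_prod_eq_sum_degree) auto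
  also have "\<dots> < card X"
    using fin xX by (rule card_Diff1_less)
  finally have deg: "degree p < card X" .
  have "0 = (\<Sum>u\<in>X. b u * poly p u)"
    using sum_poly_eq_zero[OF mom deg] by simp
  also have "\<dots> = (\<Sum>u\<in>{x}. b u * poly p u)"
    using fin xX by (intro sum.mono_neutral_right) (auto simp: p_def poly_prod)
  finally have "b x * poly p x = 0" by simp
  moreover have "poly p x \<noteq> 0"
    using fin by (auto simp: p_def poly_prod)
  ultimately show ?thesis by simp
qed

text \<open>The difference of the two sums lives on at most \<open>2 * card I\<close> nodes, so that
  many vanishing moments annihilate it. Nothing is assumed about \<open>h\<close> and
  \<open>f'\<close>: distinctness of the competing nodes is a conclusion.\<close>

lemma exponential_sum_unique:
  fixes f f' g h :: "'a \<Rightarrow> complex"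
  assumes fin: "finite I" and inj: "inj_on g I" and nz: "\<And>t. t \<in> I \<Longrightarrow> f t \<noteq> 0"
    and eq: "\<And>l. l < 2 * card I \<Longrightarrow> (\<Sum>t\<in>I. f t * g t ^ l) = (\<Sum>t\<in>I. f' t * h t ^ l)"
  shows "inj_on h I" and "h ` I = g ` I"
    and "\<And>s t. s \<in> I \<Longrightarrow> t \<in> I \<Longrightarrow> h s = g t \<Longrightarrow> f' s = f t"
proof -
  define X where "X = g ` I \<union> h ` I"
  \<comment> \<open>The net weight at \<open>x\<close>. Weights of coinciding nodes are added, since
    \<open>h\<close> is not yet known to be injective.\<close>
  define b where "b x = (\<Sum>t\<in>{t\<in>I. g t = x}. f t) - (\<Sum>t\<in>{t\<in>I. h t = x}. f' t)" for x
  have finX: "finite X" using fin by (simp add: X_def)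
  have cardX: "card X \<le> 2 * card I"
    using card_Un_le[of "g ` I" "h ` I"] card_image_le[OF fin, of g] card_image_le[OF fin, of h]
    by (simp add: X_def)
  have grp: "(\<Sum>x\<in>X. (\<Sum>t\<in>{t\<in>I. k t = x}. e t) * x ^ l) = (\<Sum>t\<in>I. e t * k t ^ l)"
    if "k ` I \<subseteq> X" for k e :: "'a \<Rightarrow> complex" and l
    using sum.group[OF fin finX that, of "\<lambda>t. e t * k t ^ l"]
    by (simp add: sum_distrib_right)
  have b0: "b x = 0" if "x \<in> X" for x
  proof (rule vanishing_moments_imp_zero[OF finX _ that])
    fix l assume "l < card X"
    then show "(\<Sum>x\<in>X. b x * x ^ l) = 0"
      using eq[of l] cardX grp[of g f l] grp[of h f' l]
      by (simp add: b_def left_diff_distrib sum_subtractf X_def)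
  qed
  have atom: "(\<Sum>s\<in>{s\<in>I. h s = g t}. f' s) = f t" if "t \<in> I" for t
  proof -
    have "{s\<in>I. g s = g t} = {t}" using inj that by (auto dest: inj_onD)
    then show ?thesis using b0[of "g t"] that by (simp add: b_def X_def)
  qed
  \<comment> \<open>A non-zero weight at \<open>g t\<close> can only be balanced by some node of
    \<open>h\<close>.\<close>
  have sub: "g ` I \<subseteq> h ` I"
  proof
    fix x assume "x \<in> g ` I"
    then obtain t where t: "t \<in> I" "x = g t" by blast
    then have "{s\<in>I. h s = g t} \<noteq> {}" using atom[of t] nz[of t] by (metis sum.empty)
    then show "x \<in> h ` I" using t by force
  qed
  have cg: "card (g ` I) = card I" using inj by (rule card_image)
  have ch: "card (h ` I) = card I"
    using card_mono[OF finite_imageI[OF fin] sub] card_image_le[OF fin, of h] cg by simp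
  show injh: "inj_on h I" using fin ch by (rule eq_card_imp_inj_on)
  show "h ` I = g ` I"
    using card_subset_eq[OF finite_imageI[OF fin] sub] cg ch by simp
  fix s t assume st: "s \<in> I" "t \<in> I" "h s = g t"
  then have "{s'\<in>I. h s' = g t} = {s}" using injh by (auto simp: inj_on_def)
  then show "f' s = f t" using atom[OF st(2)] by simp
qed

subsection \<open>Collision-free products\<close>

text \<open>Squaring linearizes the phaseless data: writing the squared modulus as a product with
  the conjugate gives an exponential sum over pairs of indices.\<close>

lemma norm_exponential_sum_squared:
  fixes c \<nu> :: "nat \<Rightarrow> complex"
  shows "complex_of_real ((cmod (\<Sum>k\<in>T. c k * cnj (\<nu> k) ^ l))\<^sup>2) =
    (\<Sum>t\<in>T \<times> T. (case t of (j, k) \<Rightarrow> cnj (c j) * c k) * (case t of (j, k) \<Rightarrow> \<nu> j * cnj (\<nu> k)) ^ l)"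
proof -
  have "complex_of_real ((cmod (\<Sum>k\<in>T. c k * cnj (\<nu> k) ^ l))\<^sup>2) =
    (\<Sum>j\<in>T. cnj (c j) * \<nu> j ^ l) * (\<Sum>k\<in>T. c k * cnj (\<nu> k) ^ l)"
    by (subst complex_norm_square) (simp add: mult.commute)
  also have "\<dots> = (\<Sum>j\<in>T. \<Sum>k\<in>T. (cnj (c j) * c k) * (\<nu> j * cnj (\<nu> k)) ^ l)"
    unfolding sum_product by (simp add: power_mult_distrib mult_ac)
  also have "\<dots> = (\<Sum>t\<in>T \<times> T. (case t of (j, k) \<Rightarrow> cnj (c j) * c k) * (case t of (j, k) \<Rightarrow> \<nu> j * cnj (\<nu> k)) ^ l)"
    by (simp add: sum.cartesian_product split_def)
  finally show ?thesis .
qed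

lemma collision_freeD:
  assumes "collision_free d \<nu>" "j < d" "k < d" "a < d" "b < d"
    and "\<nu> j * cnj (\<nu> k) = \<nu> a * cnj (\<nu> b)"
  shows "j = a" and "k = b"
  using assms unfolding collision_free_def by (auto dest!: inj_onD[where x="(j,k)" and y="(a,b)"])

lemma absolutely_collision_freeD:
  assumes acf: "absolutely_collision_free d \<nu>" and "j < d" "k < d" "a < d" "b < d"
    and "j \<noteq> k" "a \<noteq> b" and eq: "cmod (\<nu> j) * cmod (\<nu> k) = cmod (\<nu> a) * cmod (\<nu> b)"
  shows "a = j \<and> b = k \<or> a = k \<and> b = j"
proof -
  have inj: "inj_on (\<lambda>(j, k). cmod (\<nu> j) * cmod (\<nu> k)) {(j, k). k < j \<and> j < d}"
    using acf by (simp add: absolutely_collision_free_def)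
  \<comment> \<open>The definition compares only pairs whose first index is the larger one, so both
    pairs are sorted first.\<close>
  have "(max j k, min j k) = (max a b, min a b)"
    using assms(2-) by (intro inj_onD[OF inj]) (auto simp: max_def min_def mult.commute)
  then show ?thesis using assms(6,7) by (auto simp: max_def min_def split: if_splits)
qed

lemma collision_free_cmod_inj:
  assumes "collision_free d \<nu>" "j < d" "k < d" "cmod (\<nu> j) = cmod (\<nu> k)"
  shows "j = k"
proof -
  have "\<nu> j * cnj (\<nu> j) = \<nu> k * cnj (\<nu> k)"
    using assms(4) by (simp add: complex_norm_square[symmetric])
  then show ?thesis using collision_freeD[of d \<nu> j j k k] assms by blast
qed

text \<open>A zero value would make its products with the values at 0 and 1 coincide. For
  \<open>d = 1\<close> the only value may be zero.\<close>

lemma collision_free_nonzero: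
  assumes "collision_free d \<nu>" "2 \<le> d" "j < d"
  shows "\<nu> j \<noteq> 0"
proof
  assume "\<nu> j = 0"
  then show False using collision_freeD(2)[of d \<nu> j 0 j 1] assms by simp
qed

subsection \<open>Eigenvalues on a single support\<close>

text \<open>What the samples of one sampling vector reveal, with products as nodes and
  \<open>c\<close>, \<open>c'\<close> as coefficients. Which pair of indices corresponds to which is
  left open.\<close>

definition matched ::
    "nat set \<Rightarrow> (nat \<Rightarrow> complex) \<Rightarrow> (nat \<Rightarrow> complex) \<Rightarrow> (nat \<Rightarrow> complex) \<Rightarrow> (nat \<Rightarrow> complex) \<Rightarrow> bool" where
  "matched T \<nu> c \<mu> c' \<longleftrightarrow>
     inj_on (\<lambda>(j, k). \<mu> j * cnj (\<mu> k)) (T \<times> T) \<and>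
     (\<lambda>(j, k). \<mu> j * cnj (\<mu> k)) ` (T \<times> T) = (\<lambda>(j, k). \<nu> j * cnj (\<nu> k)) ` (T \<times> T) \<and>
     (\<forall>j\<in>T. \<forall>k\<in>T. \<forall>a\<in>T. \<forall>b\<in>T. \<mu> j * cnj (\<mu> k) = \<nu> a * cnj (\<nu> b) \<longrightarrow>
        cnj (c' j) * c' k = cnj (c a) * c b)"

text \<open>Pairs from \<open>T\<close> give \<open>(card T)\<^sup>2\<close> nodes, and uniqueness
  of exponential sums takes twice as many moments.\<close>

lemma matched_from_samples:
  assumes cf: "collision_free d \<nu>" and T: "T \<subseteq> {..<d}" and nz: "\<And>k. k \<in> T \<Longrightarrow> c k \<noteq> 0"
    and N: "2 * (card T)\<^sup>2 \<le> N"
    and samples: "\<And>l. l < N \<Longrightarrow>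
      cmod (\<Sum>k\<in>T. c' k * cnj (\<mu> k) ^ l) = cmod (\<Sum>k\<in>T. c k * cnj (\<nu> k) ^ l)"
  shows "matched T \<nu> c \<mu> c'"
proof -
  define f where "f = (\<lambda>(j, k). cnj (c j) * c k)"
  define f' where "f' = (\<lambda>(j, k). cnj (c' j) * c' k)"
  define g where "g = (\<lambda>(j, k). \<nu> j * cnj (\<nu> k))"
  define h where "h = (\<lambda>(j, k). \<mu> j * cnj (\<mu> k))"
  have fin: "finite (T \<times> T)" using T finite_subset by blast
  have inj: "inj_on g (T \<times> T)"
    using cf T unfolding collision_free_def g_def by (elim inj_on_subset) auto
  have f: "f t \<noteq> 0" if "t \<in> T \<times> T" for t
    using that nz by (auto simp: f_def)
  have eq: "(\<Sum>t\<in>T \<times> T. f t * g t ^ l) = (\<Sum>t\<in>T \<times> T. f' t * h t ^ l)" if "l < 2 * card (T \<times> T)" for l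
  proof -
    have "l < N" using that N by (simp add: card_cartesian_product power2_eq_square)
    then show ?thesis
      using norm_exponential_sum_squared[of c \<nu> l T] norm_exponential_sum_squared[of c' \<mu> l T] samples[of l]
      by (simp add: f_def f'_def g_def h_def)
  qed
  note u = exponential_sum_unique[OF fin inj f eq]
  have "cnj (c' j) * c' k = cnj (c a) * c b"
    if "j \<in> T" "k \<in> T" "a \<in> T" "b \<in> T" "\<mu> j * cnj (\<mu> k) = \<nu> a * cnj (\<nu> b)" for j k a b
    using u(3)[of "(j, k)" "(a, b)"] that by (simp add: f_def f'_def g_def h_def)
  then show ?thesis
    using u(1,2) unfolding matched_def g_def h_def by blast
qed

lemma matchedE:
  assumes "matched T \<nu> c \<mu> c'" "j \<in> T" "k \<in> T"
  obtains a b where "a \<in> T" "b \<in> T" "\<mu> j * cnj (\<mu> k) = \<nu> a * cnj (\<nu> b)"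
proof -
  have "\<mu> j * cnj (\<mu> k) \<in> (\<lambda>(j, k). \<nu> j * cnj (\<nu> k)) ` (T \<times> T)"
    using assms unfolding matched_def by (metis (no_types, lifting) case_prod_conv imageI mem_Sigma_iff)
  then show ?thesis using that by auto
qed

lemma matched_sym_nodes:
  assumes "matched T \<nu> c \<mu> c'" "a \<in> T" "b \<in> T"
  obtains j k where "j \<in> T" "k \<in> T" "\<mu> j * cnj (\<mu> k) = \<nu> a * cnj (\<nu> b)"
proof -
  have "\<nu> a * cnj (\<nu> b) \<in> (\<lambda>(j, k). \<mu> j * cnj (\<mu> k)) ` (T \<times> T)"
    using assms unfolding matched_def by (metis (no_types, lifting) case_prod_conv imageI mem_Sigma_iff)
  then show ?thesis using that by auto
qed

lemma matched_inj:
  assumes "matched T \<nu> c \<mu> c'" "j \<in> T" "k \<in> T" "a \<in> T" "b \<in> T"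
    and "\<mu> j * cnj (\<mu> k) = \<mu> a * cnj (\<mu> b)"
  shows "j = a \<and> k = b"
  using assms unfolding matched_def by (auto dest!: inj_onD[where x="(j,k)" and y="(a,b)"])

lemma mult_cnj_swap: "x * cnj y = z * cnj z \<Longrightarrow> x * cnj y = y * cnj x"
  by (metis complex_cnj_cnj complex_cnj_mult mult.commute)

lemma cmod_eq_iff_mult_cnj: "cmod a = cmod b \<longleftrightarrow> a * cnj a = b * cnj b"
  by (metis complex_norm_square of_real_eq_iff norm_ge_zero power2_eq_iff_nonneg)

text \<open>The real nodes are exactly the squared moduli.\<close>

lemma matched_moduli:
  assumes cf: "collision_free d \<nu>" and T: "T \<subseteq> {..<d}" and m: "matched T \<nu> c \<mu> c'"
  shows "(\<lambda>k. cmod (\<mu> k)) ` T = (\<lambda>k. cmod (\<nu> k)) ` T"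
proof (intro equalityI subsetI; elim imageE)
  fix x j assume j: "x = cmod (\<mu> j)" "j \<in> T"
  obtain a b where ab: "a \<in> T" "b \<in> T" and eq: "\<mu> j * cnj (\<mu> j) = \<nu> a * cnj (\<nu> b)"
    using matchedE[OF m j(2) j(2)] .
  \<comment> \<open>The node is a squared modulus, hence real, so the pair and its swap have the
    same product. Only diagonal pairs do.\<close>
  have "\<nu> a * cnj (\<nu> b) = \<nu> b * cnj (\<nu> a)"
    using mult_cnj_swap[OF eq[symmetric]] .
  then have "a = b" using collision_freeD(1)[OF cf] ab T by blast
  then show "x \<in> (\<lambda>k. cmod (\<nu> k)) ` T" using eq ab(1) j(1) by (auto simp: cmod_eq_iff_mult_cnj)
next
  fix x a assume a: "x = cmod (\<nu> a)" "a \<in> T"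
  obtain j k where jk: "j \<in> T" "k \<in> T" and eq: "\<mu> j * cnj (\<mu> k) = \<nu> a * cnj (\<nu> a)"
    using matched_sym_nodes[OF m a(2) a(2)] .
  have "\<mu> j * cnj (\<mu> k) = \<mu> k * cnj (\<mu> j)"
    using mult_cnj_swap[OF eq] .
  then have "j = k" using matched_inj[OF m] jk by blast
  then show "x \<in> (\<lambda>k. cmod (\<mu> k)) ` T" using eq jk(1) a(1) by (metis cmod_eq_iff_mult_cnj imageI)
qed

text \<open>Once the moduli are known, the modulus of a node determines the unordered pair of
  indices by absolute freeness of collisions. Only the order, that is a conjugation, stays
  open.\<close>

lemma matched_pair:
  assumes acf: "absolutely_collision_free d \<nu>" and T: "T \<subseteq> {..<d}" and m: "matched T \<nu> c \<mu> c'"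
    and moduli: "\<And>k. k \<in> T \<Longrightarrow> cmod (\<mu> k) = cmod (\<nu> k)"
    and jk: "j \<in> T" "k \<in> T" "j \<noteq> k"
  shows "\<mu> j * cnj (\<mu> k) = \<nu> j * cnj (\<nu> k) \<or> \<mu> j * cnj (\<mu> k) = \<nu> k * cnj (\<nu> j)"
proof -
  obtain a b where ab: "a \<in> T" "b \<in> T" and eq: "\<mu> j * cnj (\<mu> k) = \<nu> a * cnj (\<nu> b)"
    using matchedE[OF m jk(1,2)] .
  \<comment> \<open>A diagonal partner would be real, and by injectivity of the competing products
    \<open>j\<close> and \<open>k\<close> would agree.\<close>
  have "a \<noteq> b"
  proof
    assume "a = b"
    then have "\<mu> j * cnj (\<mu> k) = \<mu> k * cnj (\<mu> j)"
      using mult_cnj_swap[of "\<mu> j" "\<mu> k" "\<nu> a"] eq by simp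
    then show False using matched_inj[OF m] jk by blast
  qed
  moreover have "cmod (\<nu> j) * cmod (\<nu> k) = cmod (\<nu> a) * cmod (\<nu> b)"
    using arg_cong[OF eq, of cmod] moduli jk by (simp add: norm_mult)
  ultimately have "a = j \<and> b = k \<or> a = k \<and> b = j"
    using absolutely_collision_freeD[OF acf, of j k a b] jk ab T by blast
  then show ?thesis using eq by auto
qed

text \<open>The pair \<open>(s, u)\<close> encodes a linear isometry of the plane: a rotation by
  \<open>u\<close>, preceded by complex conjugation if \<open>s\<close> is false. A single parameter
  can be propagated through overlaps.\<close>

definition aligned_with :: "(nat \<Rightarrow> complex) \<Rightarrow> (nat \<Rightarrow> complex) \<Rightarrow> bool \<times> complex \<Rightarrow> nat \<Rightarrow> bool" where
  "aligned_with \<nu> \<mu> = (\<lambda>(s, u) k. cmod u = 1 \<and> \<mu> k = u * (if s then \<nu> k else cnj (\<nu> k)))"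

lemma aligned_from_base:
  assumes "\<mu> a * cnj (\<mu> k) = (if s then \<nu> a * cnj (\<nu> k) else \<nu> k * cnj (\<nu> a))"
    and "cmod (\<mu> a) = cmod (\<nu> a)" "\<nu> a \<noteq> 0"
  shows "aligned_with \<nu> \<mu> (s, (if s then cnj (\<nu> a) else \<nu> a) / cnj (\<mu> a)) k"
proof -
  have "\<mu> a \<noteq> 0" using assms by auto
  moreover have "cnj (\<mu> a) * \<mu> k = (if s then cnj (\<nu> a) * \<nu> k else cnj (\<nu> k) * \<nu> a)"
    using arg_cong[OF assms(1), of cnj] by (cases s) (simp_all add: mult.commute)
  ultimately show ?thesis
    using assms by (auto simp: aligned_with_def norm_divide field_simps)
qed

text \<open>Relative to a base index \<open>a\<close>, each other index either keeps or conjugates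
  its product. Mixed choices at \<open>j\<close> and \<open>k\<close> would contradict both options
  for the pair \<open>(j, k)\<close>.\<close>

lemma matched_aligned:
  assumes acf: "absolutely_collision_free d \<nu>" and d: "2 \<le> d"
    and T: "T \<subseteq> {..<d}" and m: "matched T \<nu> c \<mu> c'"
    and moduli: "\<And>k. k \<in> T \<Longrightarrow> cmod (\<mu> k) = cmod (\<nu> k)"
  shows "\<exists>p. \<forall>k\<in>T. aligned_with \<nu> \<mu> p k"
proof (cases "T = {}")
  case False
  then obtain a where a: "a \<in> T" by blast
  have cf: "collision_free d \<nu>" using acf by (simp add: absolutely_collision_free_def)
  have nz: "\<nu> k \<noteq> 0" if "k \<in> T" for k using collision_free_nonzero[OF cf d] that T by blast
  define v where "v j k = \<nu> j * cnj (\<nu> k)" for j k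
  define u where "u j k = \<mu> j * cnj (\<mu> k)" for j k
  have vnz: "v j k \<noteq> 0" if "j \<in> T" "k \<in> T" for j k using that nz by (simp add: v_def)
  have pair: "u j k = v j k \<or> u j k = v k j" if "j \<in> T" "k \<in> T" for j k
  proof (cases "j = k")
    case True
    then show ?thesis using moduli[OF that(1)] by (simp add: u_def v_def cmod_eq_iff_mult_cnj)
  next
    case False
    then show ?thesis using matched_pair[OF acf T m moduli that] by (simp add: u_def v_def)
  qed
  have v_neq: "v j k \<noteq> v k j" if "j \<in> T" "k \<in> T" "j \<noteq> k" for j k
    using collision_freeD(1)[OF cf, of j k k j] that T unfolding v_def by blast
  have uaa: "u a a = v a a" using pair[OF a a] by blast
  have "(\<forall>k\<in>T. u a k = v a k) \<or> (\<forall>k\<in>T. u a k = v k a)"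
  proof (rule ccontr)
    assume "\<not> ?thesis"
    then obtain j k where jk: "j \<in> T" "k \<in> T" "u a j \<noteq> v j a" "u a k \<noteq> v a k" by blast
    then have aj: "u a j = v a j" and ak: "u a k = v k a" using pair a by blast+
    have ne: "a \<noteq> j" "a \<noteq> k" using jk uaa by auto
    have "u j a = v j a" using arg_cong[OF aj, of cnj] by (simp add: u_def v_def mult.commute)
    \<comment> \<open>The product for \<open>(j, k)\<close> times the squared modulus at
      \<open>a\<close> factors through the products for \<open>(j, a)\<close> and
      \<open>(a, k)\<close>.\<close>
    then have cocycle: "u j k * v a a = v j a * v k a"
      by (simp flip: ak uaa add: u_def mult_ac)
    from pair[OF jk(1,2)] show False
    proof
      assume "u j k = v j k"
      then have "v j a * v a k = v j a * v k a" using cocycle by (simp add: v_def mult_ac)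
      then show False using vnz v_neq[OF a jk(2) ne(2)] jk a by simp
    next
      assume "u j k = v k j"
      then have "v k a * v a j = v k a * v j a" using cocycle by (simp add: v_def mult_ac)
      then show False using vnz v_neq[OF a jk(1) ne(1)] jk a by simp
    qed
  qed
  then obtain s where "\<forall>k\<in>T. u a k = (if s then v a k else v k a)" by metis
  then show ?thesis
    using aligned_from_base[of \<mu> a _ s \<nu>] moduli[OF a] nz[OF a] unfolding u_def v_def by blast
qed auto

text \<open>The product over \<open>a\<close> and \<open>b\<close> does not depend on the rotation
  and reveals the conjugation; a non-zero value then gives the rotation. One index would not
  suffice, since a reflection followed by a suitable rotation fixes any given point.\<close>

lemma aligned_unique:
  assumes cf: "collision_free d \<nu>" and d: "2 \<le> d" and ab: "a < d" "b < d" "a \<noteq> b"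
    and p: "aligned_with \<nu> \<mu> p a" "aligned_with \<nu> \<mu> p b"
    and q: "aligned_with \<nu> \<mu> q a" "aligned_with \<nu> \<mu> q b"
  shows "p = q"
proof -
  obtain s u t v where pq: "p = (s, u)" "q = (t, v)" by fastforce
  have prod: "\<mu> a * cnj (\<mu> b) = (if s then \<nu> a * cnj (\<nu> b) else \<nu> b * cnj (\<nu> a))"
    if "aligned_with \<nu> \<mu> (s, u) a" "aligned_with \<nu> \<mu> (s, u) b" for s u
  proof -
    have "u * cnj u = 1" using that by (simp add: aligned_with_def complex_norm_square[symmetric])
    then have "u * x * cnj (u * y) = x * cnj y" for x y
      by (metis (no_types) complex_cnj_mult mult.assoc mult.commute mult.right_neutral)
    then show ?thesis using that by (simp add: aligned_with_def mult.commute)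
  qed
  have st: "s = t"
    using prod[of s u] prod[of t v] p q pq collision_freeD(1)[OF cf, of a b b a] ab
    by (auto split: if_splits)
  moreover have "u = v"
    using p(1) q(1) st collision_free_nonzero[OF cf d ab(1)]
    by (auto simp: pq aligned_with_def split: if_splits)
  ultimately show ?thesis using pq by simp
qed

subsection \<open>From the supports to all indices\<close>

text \<open>The property \<open>P\<close> is kept abstract because the argument serves twice: for
  the isometry of the eigenvalues and for the global phase of the signal. Two shared indices force
  the parameter of each new support to agree with the previous one.\<close>

lemma phase_propagation_glue:
  assumes pp: "phase_propagation J \<psi>"
    and loc: "\<And>i. i < J \<Longrightarrow> \<exists>p. \<forall>k\<in>supp (\<psi> i). P p k"
    and uniq: "\<And>i a b p q. i < J \<Longrightarrow> a \<in> supp (\<psi> i) \<Longrightarrow> b \<in> supp (\<psi> i) \<Longrightarrow> a \<noteq> b \<Longrightarrow>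
      P p a \<Longrightarrow> P p b \<Longrightarrow> P q a \<Longrightarrow> P q b \<Longrightarrow> p = q"
    and n: "n \<le> J"
  shows "\<exists>p. \<forall>k\<in>(\<Union>i<n. supp (\<psi> i)). P p k"
  using n
proof (induction n)
  case (Suc n)
  from Suc obtain p where p: "\<forall>k\<in>(\<Union>i<n. supp (\<psi> i)). P p k" by auto
  obtain q where q: "\<forall>k\<in>supp (\<psi> n). P q k" using loc[of n] Suc.prems by auto
  show ?case
  proof (cases "n = 0")
    case True
    then show ?thesis using q by auto
  next
    case False
    then have "2 \<le> card (supp (\<psi> n) \<inter> (\<Union>i<n. supp (\<psi> i)))"
      using pp Suc.prems by (simp add: phase_propagation_def)
    then obtain a b where ab: "a \<noteq> b" "{a, b} \<subseteq> supp (\<psi> n) \<inter> (\<Union>i<n. supp (\<psi> i))"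
      by (metis card_2_iff obtain_subset_with_card_n)
    then have "p = q" using uniq[of n a b p q] p q Suc.prems by auto
    then show ?thesis using p q by (auto simp: lessThan_Suc)
  qed
qed auto

text \<open>Being onto a finite set, the map is a permutation, so it preserves membership and
  non-membership in each support. A singleton cut out by supports is therefore fixed.\<close>

lemma index_separation_permutation_trivial:
  assumes sep: "index_separation d J \<psi>"
    and surj: "\<And>i. i < J \<Longrightarrow> \<pi> ` supp (\<psi> i) = supp (\<psi> i)" and k: "k < d"
  shows "\<pi> k = k"
proof -
  have cover: "(\<Union>i<J. supp (\<psi> i)) = {..<d}" using sep by (simp add: index_separation_def)
  have "\<pi> ` {..<d} = {..<d}"
    unfolding cover[symmetric] image_UN using surj by simp
  then have inj: "inj_on \<pi> {..<d}" by (simp add: eq_card_imp_inj_on)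
  obtain F G where FG: "F \<subseteq> {..<J}" "G \<subseteq> {..<J}"
      "{k} = (\<Inter>i\<in>F. supp (\<psi> i)) - (\<Union>i\<in>G. supp (\<psi> i))"
    using sep[unfolded index_separation_def, THEN conjunct2, rule_format, OF k]
    by (elim exE conjE) (rule that)
  have stable: "\<pi> k \<in> supp (\<psi> i) \<longleftrightarrow> k \<in> supp (\<psi> i)" if i: "i < J" for i
  proof
    assume "\<pi> k \<in> supp (\<psi> i)"
    then have "\<pi> k \<in> \<pi> ` supp (\<psi> i)" by (simp only: surj[OF i])
    then obtain m where m: "m \<in> supp (\<psi> i)" "\<pi> k = \<pi> m" by blast
    then have "m < d" using cover i by blast
    then have "k = m" using inj_onD[OF inj m(2)] k by simp
    then show "k \<in> supp (\<psi> i)" using m(1) by simp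
  next
    assume "k \<in> supp (\<psi> i)"
    then have "\<pi> k \<in> \<pi> ` supp (\<psi> i)" by (rule imageI)
    then show "\<pi> k \<in> supp (\<psi> i)" by (simp only: surj[OF i])
  qed
  have "k \<in> (\<Inter>i\<in>F. supp (\<psi> i)) - (\<Union>i\<in>G. supp (\<psi> i))"
    unfolding FG(3)[symmetric] by simp
  moreover have "\<pi> k \<in> supp (\<psi> i) \<longleftrightarrow> k \<in> supp (\<psi> i)" if "i \<in> F \<union> G" for i
    using stable FG(1,2) that by auto
  ultimately have "\<pi> k \<in> (\<Inter>i\<in>F. supp (\<psi> i)) - (\<Union>i\<in>G. supp (\<psi> i))"
    by simp
  then show ?thesis unfolding FG(3)[symmetric] by simp
qed

lemma moduli_identification:
  assumes cf: "collision_free d \<nu>" and sep: "index_separation d J \<psi>"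
    and moduli: "\<And>i. i < J \<Longrightarrow> (\<lambda>k. cmod (\<mu> k)) ` supp (\<psi> i) = (\<lambda>k. cmod (\<nu> k)) ` supp (\<psi> i)"
    and k: "k < d"
  shows "cmod (\<mu> k) = cmod (\<nu> k)"
proof -
  have cover: "(\<Union>i<J. supp (\<psi> i)) = {..<d}" using sep by (simp add: index_separation_def)
  have inj: "inj_on (\<lambda>k. cmod (\<nu> k)) {..<d}"
    using collision_free_cmod_inj[OF cf] by (auto intro: inj_onI)
  \<comment> \<open>The true moduli are distinct and thus label the indices: \<open>\<pi> k\<close>
    is the index whose true modulus is the competing modulus at \<open>k\<close>.\<close>
  define \<pi> where "\<pi> k = the_inv_into {..<d} (\<lambda>k. cmod (\<nu> k)) (cmod (\<mu> k))" for k
  have surj: "\<pi> ` supp (\<psi> i) = supp (\<psi> i)" if "i < J" for i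
  proof -
    have sub: "supp (\<psi> i) \<subseteq> {..<d}" using cover that by blast
    have "\<pi> ` supp (\<psi> i) =
        the_inv_into {..<d} (\<lambda>k. cmod (\<nu> k)) ` (\<lambda>k. cmod (\<mu> k)) ` supp (\<psi> i)"
      by (simp add: \<pi>_def image_image)
    also have "\<dots> = (\<lambda>a. the_inv_into {..<d} (\<lambda>k. cmod (\<nu> k)) (cmod (\<nu> a))) ` supp (\<psi> i)"
      by (simp only: moduli[OF that] image_image)
    also have "\<dots> = (\<lambda>a. a) ` supp (\<psi> i)"
      using sub by (intro image_cong refl the_inv_into_f_f[OF inj]) auto
    finally show ?thesis by simp
  qed
  have "\<pi> k = k" using index_separation_permutation_trivial[OF sep surj k] .
  moreover obtain i where i: "i < J" "k \<in> supp (\<psi> i)" using cover k by blast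
  then have "cmod (\<mu> k) \<in> (\<lambda>k. cmod (\<nu> k)) ` {..<d}"
    using moduli[OF i(1)] cover by blast
  then have "cmod (\<nu> (\<pi> k)) = cmod (\<mu> k)"
    unfolding \<pi>_def by (rule f_the_inv_into_f[OF inj])
  ultimately show ?thesis by simp
qed

text \<open>The product \<open>p * cnj q\<close> is real and has argument
  \<open>Arg p - Arg q\<close> modulo full turns, so the sine of this difference vanishes.\<close>

lemma real_quotient_imp_Arg_rcong:
  assumes "p \<noteq> 0" "q \<noteq> 0" and "p * cnj q = cnj p * q"
  shows "[Arg p = Arg q] (rmod pi)"
proof -
  have polar: "z = of_real (cmod z) * cis (Arg z)" for z
    using rcis_cmod_Arg[of z] by (simp add: rcis_def)
  have "p * cnj q = of_real (cmod p * cmod q) * cis (Arg p - Arg q)"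
    by (subst polar[of p], subst polar[of q]) (simp add: cis_cnj cis_mult)
  moreover have "Im (p * cnj q) = 0"
    using arg_cong[OF assms(3), of Im] by simp
  ultimately have "sin (Arg p - Arg q) = 0" using assms(1,2) by simp
  then obtain n :: int where "Arg p - Arg q = of_int n * pi" using sin_zero_iff_int2 by blast
  then have "Arg p = Arg q + of_int n * pi" by simp
  then show ?thesis unfolding rcong_altdef by (intro exI[of _ "- n"]) simp
qed

text \<open>The matrix-free core: \<open>y\<close> and \<open>w\<close> stand for the coefficients
  of the true and the competing signal under the adjoint of the eigenvector basis.\<close>

lemma spectrum_and_signal_identification:
  assumes acf: "absolutely_collision_free d \<nu>"
    and sep: "index_separation d J \<psi>" and pp: "phase_propagation J \<psi>" and wd: "winding_direction d J \<psi>"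
    and dim: "\<And>i. i < J \<Longrightarrow> dim_vec (\<psi> i) = d" and y: "\<And>k. k < d \<Longrightarrow> y k \<noteq> 0"
    and N: "\<And>i. i < J \<Longrightarrow> 2 * (card (supp (\<psi> i)))\<^sup>2 \<le> N"
    and samples: "\<And>i l. i < J \<Longrightarrow> l < N \<Longrightarrow>
      cmod (\<Sum>k\<in>supp (\<psi> i). w k * cnj (\<psi> i $ k) * cnj (\<mu> k) ^ l) =
      cmod (\<Sum>k\<in>supp (\<psi> i). y k * cnj (\<psi> i $ k) * cnj (\<nu> k) ^ l)"
  shows "\<exists>u. cmod u = 1 \<and> (\<forall>k<d. \<mu> k = u * \<nu> k)"
    and "\<exists>e. cmod e = 1 \<and> (\<forall>k<d. w k = e * y k)"
proof -
  have cf: "collision_free d \<nu>" using acf by (simp add: absolutely_collision_free_def)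
  have cover: "(\<Union>i<J. supp (\<psi> i)) = {..<d}" using sep by (simp add: index_separation_def)
  have sub: "supp (\<psi> i) \<subseteq> {..<d}" if "i < J" for i using cover that by blast
  obtain i1 i2 k1 k2 where wi: "i1 < J" "i2 < J" "k1 < d" "k2 < d"
    and nz: "\<psi> i1 $ k1 * cnj (\<psi> i1 $ k2) \<noteq> 0" "\<psi> i2 $ k1 * cnj (\<psi> i2 $ k2) \<noteq> 0"
    and arg: "\<not> [Arg (\<psi> i1 $ k1 * cnj (\<psi> i1 $ k2)) = Arg (\<psi> i2 $ k1 * cnj (\<psi> i2 $ k2))] (rmod pi)"
    using wd unfolding winding_direction_def by blast
  \<comment> \<open>For equal indices both products would be real. The winding direction thus also
    supplies \<open>2 \<le> d\<close>.\<close>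
  have "k1 \<noteq> k2"
    using arg real_quotient_imp_Arg_rcong[OF nz] by (auto simp: mult_ac)
  then have d: "2 \<le> d" using wi by linarith
  have m: "matched (supp (\<psi> i)) \<nu> (\<lambda>k. y k * cnj (\<psi> i $ k)) \<mu> (\<lambda>k. w k * cnj (\<psi> i $ k))"
    if "i < J" for i
  proof (rule matched_from_samples[OF cf sub[OF that] _ N[OF that] samples[OF that]])
    fix k assume k: "k \<in> supp (\<psi> i)"
    then have "y k \<noteq> 0" using y sub[OF that] by blast
    then show "y k * cnj (\<psi> i $ k) \<noteq> 0" using k by (simp add: supp_def)
  qed
  have moduli: "cmod (\<mu> k) = cmod (\<nu> k)" if "k < d" for k
    using moduli_identification[OF cf sep matched_moduli[OF cf sub m] that] by blast
  have coeff: "cnj (w j) * w k * (\<psi> i $ j * cnj (\<psi> i $ k)) = cnj (y a) * y b * (\<psi> i $ a * cnj (\<psi> i $ b))"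
    if "i < J" "j \<in> supp (\<psi> i)" "k \<in> supp (\<psi> i)" "a \<in> supp (\<psi> i)" "b \<in> supp (\<psi> i)"
      "\<mu> j * cnj (\<mu> k) = \<nu> a * cnj (\<nu> b)" for i j k a b
  proof -
    have "cnj (w j * cnj (\<psi> i $ j)) * (w k * cnj (\<psi> i $ k)) =
        cnj (y a * cnj (\<psi> i $ a)) * (y b * cnj (\<psi> i $ b))"
      using m[OF that(1)] that(2-) unfolding matched_def by blast
    then show ?thesis by (simp add: mult_ac)
  qed
  have "\<exists>p. \<forall>k\<in>(\<Union>i<J. supp (\<psi> i)). aligned_with \<nu> \<mu> p k"
  proof (rule phase_propagation_glue[where P = "aligned_with \<nu> \<mu>", OF pp _ _ order_refl])
    show "\<exists>p. \<forall>k\<in>supp (\<psi> i). aligned_with \<nu> \<mu> p k" if "i < J" for i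
      using matched_aligned[OF acf d sub[OF that] m[OF that] moduli] sub[OF that] by blast
  next
    fix i a b p q
    assume i: "i < J" "a \<in> supp (\<psi> i)" "b \<in> supp (\<psi> i)" and "a \<noteq> b"
      "aligned_with \<nu> \<mu> p a" "aligned_with \<nu> \<mu> p b" "aligned_with \<nu> \<mu> q a" "aligned_with \<nu> \<mu> q b"
    moreover have "a < d" "b < d" using sub[OF i(1)] i by auto
    ultimately show "p = q" using aligned_unique[OF cf d] by blast
  qed
  then obtain s u where su: "\<And>k. k < d \<Longrightarrow> aligned_with \<nu> \<mu> (s, u) k"
    unfolding cover by auto
  then have u1: "cmod u = 1" using su[of 0] d by (simp add: aligned_with_def)
  have uu: "(u * x) * cnj (u * z) = x * cnj z" for x z
  proof -
    have "u * cnj u = 1" using u1 by (simp add: complex_norm_square[symmetric])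
    then show ?thesis by (metis (no_types) complex_cnj_mult mult.assoc mult.commute mult.right_neutral)
  qed
  \<comment> \<open>Under a conjugation, the competing node at \<open>(k1, k2)\<close> is the true
    node at \<open>(k2, k1)\<close>, so both sampling vectors compare weights with swapped
    indices.\<close>
  have s
  proof (rule ccontr)
    assume "\<not> s"
    then have "\<mu> k1 = u * cnj (\<nu> k1)" "\<mu> k2 = u * cnj (\<nu> k2)"
      using su[OF wi(3)] su[OF wi(4)] by (simp_all add: aligned_with_def)
    then have mu: "\<mu> k1 * cnj (\<mu> k2) = \<nu> k2 * cnj (\<nu> k1)"
      by (simp only: uu complex_cnj_cnj mult.commute)
    define W Y where "W = cnj (w k1) * w k2" and "Y = cnj (y k2) * y k1"
    define p q where "p = \<psi> i1 $ k1 * cnj (\<psi> i1 $ k2)" and "q = \<psi> i2 $ k1 * cnj (\<psi> i2 $ k2)"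
    have in_supp: "k1 \<in> supp (\<psi> i) \<and> k2 \<in> supp (\<psi> i)"
      if "i < J" "\<psi> i $ k1 * cnj (\<psi> i $ k2) \<noteq> 0" for i
      using that wi dim by (simp add: supp_def)
    have Wp: "W * p = Y * cnj p"
      using coeff[OF wi(1) _ _ _ _ mu] in_supp[OF wi(1) nz(1)]
      by (simp add: W_def Y_def p_def mult.commute)
    have Wq: "W * q = Y * cnj q"
      using coeff[OF wi(2) _ _ _ _ mu] in_supp[OF wi(2) nz(2)]
      by (simp add: W_def Y_def q_def mult.commute)
    \<comment> \<open>The signal factors \<open>W\<close> and \<open>Y\<close> are common to both
      sampling vectors. Eliminating \<open>W\<close> makes \<open>p * cnj q\<close> real, against
      the winding direction.\<close>
    have "Y * (p * cnj q) = p * (W * q)" unfolding Wq by (simp add: mult_ac)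
    also have "\<dots> = q * (W * p)" by (simp add: mult_ac)
    also have "\<dots> = Y * (cnj p * q)" unfolding Wp by (simp add: mult_ac)
    finally have "Y * (p * cnj q) = Y * (cnj p * q)" .
    moreover have "Y \<noteq> 0" using y wi by (simp add: Y_def)
    ultimately show False
      using real_quotient_imp_Arg_rcong[OF nz] arg by (simp add: p_def q_def)
  qed
  then have mu: "\<mu> k = u * \<nu> k" if "k < d" for k using su[OF that] by (simp add: aligned_with_def)
  then show "\<exists>u. cmod u = 1 \<and> (\<forall>k<d. \<mu> k = u * \<nu> k)" using u1 by blast
  have wy: "cnj (w j) * w k = cnj (y j) * y k" if "i < J" "j \<in> supp (\<psi> i)" "k \<in> supp (\<psi> i)" for i j k
  proof -
    have "j < d" "k < d" using that sub by blast+
    then have "\<mu> j * cnj (\<mu> k) = \<nu> j * cnj (\<nu> k)" by (simp only: mu uu)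
    then have "cnj (w j) * w k * (\<psi> i $ j * cnj (\<psi> i $ k)) = cnj (y j) * y k * (\<psi> i $ j * cnj (\<psi> i $ k))"
      by (rule coeff[OF that that(2,3)])
    then show ?thesis using that by (simp add: supp_def)
  qed
  \<comment> \<open>Gluing again, now for the phase of the signal; here one shared index already
    determines \<open>e\<close>, as \<open>y\<close> has no zeros.\<close>
  have "\<exists>e. \<forall>k\<in>(\<Union>i<J. supp (\<psi> i)). cmod e = 1 \<and> w k = e * y k"
  proof (rule phase_propagation_glue[where P = "\<lambda>e k. cmod e = 1 \<and> w k = e * y k", OF pp _ _ order_refl])
    fix i assume i: "i < J"
    show "\<exists>e. \<forall>k\<in>supp (\<psi> i). cmod e = 1 \<and> w k = e * y k"
    proof (cases "supp (\<psi> i) = {}")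
      case False
      then obtain a where a: "a \<in> supp (\<psi> i)" by blast
      then have ya: "y a \<noteq> 0" using y sub[OF i] by blast
      have "cmod (w a) = cmod (y a)"
        using wy[OF i a a] by (simp add: cmod_eq_iff_mult_cnj mult.commute)
      moreover from this have "cnj (w a) \<noteq> 0" using ya by auto
      ultimately have "cmod (cnj (y a) / cnj (w a)) = 1" "w k = cnj (y a) / cnj (w a) * y k"
        if "k \<in> supp (\<psi> i)" for k
        using wy[OF i a that] ya by (auto simp: norm_divide field_simps)
      then show ?thesis by blast
    qed auto
  next
    fix i a b p q assume "i < J" "a \<in> supp (\<psi> i)" "cmod p = 1 \<and> w a = p * y a" "cmod q = 1 \<and> w a = q * y a"
    then show "p = q" using y[of a] sub by auto
  qed
  then obtain e where e: "\<And>k. k < d \<Longrightarrow> cmod e = 1 \<and> w k = e * y k" unfolding cover by auto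
  then show "\<exists>e. cmod e = 1 \<and> (\<forall>k<d. w k = e * y k)" using e[of 0] d by (intro exI[of _ e]) auto
qed

subsection \<open>Samples in the eigenvector basis\<close>

lemma index_mat_adjoint:
  assumes "i < dim_col A" "j < dim_row A"
  shows "mat_adjoint A $$ (i, j) = conjugate (A $$ (j, i))"
  using assms by (simp add: mat_adjoint_def mat_of_rows_index)

lemma cscalar_prod_mult_mat_vec:
  fixes A :: "complex mat"
  assumes A: "A \<in> carrier_mat m n" and x: "x \<in> carrier_vec m" and v: "v \<in> carrier_vec n"
  shows "x \<bullet>c (A *\<^sub>v v) = (mat_adjoint A *\<^sub>v x) \<bullet>c v"
proof -
  have dim: "dim_row (mat_adjoint A) = n" "dim_col (mat_adjoint A) = m"
    using A by (auto simp: mat_adjoint_def)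
  have "x \<bullet>c (A *\<^sub>v v) = (\<Sum>i<m. \<Sum>k<n. x $ i * cnj (A $$ (i, k) * v $ k))"
    using A x v by (simp add: scalar_prod_def sum_distrib_left lessThan_atLeast0)
  also have "\<dots> = (\<Sum>k<n. \<Sum>i<m. x $ i * cnj (A $$ (i, k) * v $ k))"
    by (rule sum.swap)
  also have "\<dots> = (mat_adjoint A *\<^sub>v x) \<bullet>c v"
    using A x v dim
    by (simp add: scalar_prod_def sum_distrib_left lessThan_atLeast0 index_mat_adjoint mult_ac)
  finally show ?thesis .
qed

lemma diagonalized_pow_mult_vec:
  fixes S Sinv :: "complex mat"
  assumes S: "S \<in> carrier_mat d d" and Sinv: "Sinv \<in> carrier_mat d d" and inv: "Sinv * S = 1\<^sub>m d"
    and v: "v \<in> carrier_vec d"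
  shows "(S * mat_diag d \<mu> * Sinv) ^\<^sub>m l *\<^sub>v (S *\<^sub>v v) = S *\<^sub>v vec d (\<lambda>k. \<mu> k ^ l * v $ k)"
  using v
\<comment> \<open>The vector is generalized because one application of the matrix rescales its
  coordinates.\<close>
proof (induction l arbitrary: v)
  case 0
  then have "vec d (\<lambda>k. \<mu> k ^ 0 * v $ k) = v" by auto
  then show ?case using S Sinv 0 by simp
next
  case (Suc l)
  let ?A = "S * mat_diag d \<mu> * Sinv"
  have A: "?A \<in> carrier_mat d d" using S Sinv by (auto intro!: mult_carrier_mat[of _ d d])
  have D: "mat_diag d \<mu> \<in> carrier_mat d d" by simp
  have "Sinv *\<^sub>v (S *\<^sub>v v) = v"
    using inv S Sinv Suc.prems by (simp flip: assoc_mult_mat_vec)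
  then have "?A *\<^sub>v (S *\<^sub>v v) = S *\<^sub>v (mat_diag d \<mu> *\<^sub>v v)"
    using S Sinv D Suc.prems by (simp add: assoc_mult_mat_vec[of _ d d _ d])
  also have "mat_diag d \<mu> *\<^sub>v v = vec d (\<lambda>k. \<mu> k * v $ k)" (is "_ = ?v")
  proof (rule eq_vecI)
    fix k assume "k < dim_vec ?v"
    then have k: "k < d" by simp
    have "(mat_diag d \<mu> *\<^sub>v v) $ k = (\<Sum>j<d. (if k = j then \<mu> j else 0) * v $ j)"
      using k Suc.prems by (simp add: mat_diag_def scalar_prod_def lessThan_atLeast0)
    also have "\<dots> = (\<Sum>j<d. if k = j then \<mu> j * v $ j else 0)"
      by (intro sum.cong) auto
    also have "\<dots> = ?v $ k" using k by simp
    finally show "(mat_diag d \<mu> *\<^sub>v v) $ k = ?v $ k" .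
  qed (simp add: mat_diag_def)
  finally have step: "?A *\<^sub>v (S *\<^sub>v v) = S *\<^sub>v ?v" .
  have "?A ^\<^sub>m Suc l *\<^sub>v (S *\<^sub>v v) = ?A ^\<^sub>m l *\<^sub>v (?A *\<^sub>v (S *\<^sub>v v))"
    using A S Suc.prems by (simp add: assoc_mult_mat_vec[of _ d d _ d] pow_carrier_mat)
  also have "\<dots> = S *\<^sub>v vec d (\<lambda>k. \<mu> k ^ l * ?v $ k)"
    unfolding step by (rule Suc.IH) simp
  also have "vec d (\<lambda>k. \<mu> k ^ l * ?v $ k) = vec d (\<lambda>k. \<mu> k ^ Suc l * v $ k)"
    by (intro eq_vecI) auto
  finally show ?case .
qed

text \<open>Moving \<open>S\<close> across the inner product leaves a diagonal action on
  coordinates. The conjugates come from the second argument of the inner product.\<close>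

lemma st_sample_diagonalized:
  assumes S: "S \<in> carrier_mat d d" and Sinv: "Sinv \<in> carrier_mat d d"
    and inv: "S * Sinv = 1\<^sub>m d" "Sinv * S = 1\<^sub>m d"
    and \<phi>: "\<phi> i \<in> carrier_vec d" and z: "z \<in> carrier_vec d"
  shows "st_sample (S * mat_diag d \<mu> * Sinv) \<phi> z (i, l) =
    cmod (\<Sum>k\<in>supp (Sinv *\<^sub>v \<phi> i). (mat_adjoint S *\<^sub>v z) $ k * cnj ((Sinv *\<^sub>v \<phi> i) $ k) * cnj (\<mu> k) ^ l)"
proof -
  let ?\<psi> = "Sinv *\<^sub>v \<phi> i"
  have \<psi>: "?\<psi> \<in> carrier_vec d" using Sinv \<phi> by simp
  have "S *\<^sub>v ?\<psi> = \<phi> i" using inv S Sinv \<phi> by (simp flip: assoc_mult_mat_vec)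
  then have "(S * mat_diag d \<mu> * Sinv) ^\<^sub>m l *\<^sub>v \<phi> i = S *\<^sub>v vec d (\<lambda>k. \<mu> k ^ l * ?\<psi> $ k)"
    using diagonalized_pow_mult_vec[OF S Sinv inv(2) \<psi>] by simp
  then have "z \<bullet>c ((S * mat_diag d \<mu> * Sinv) ^\<^sub>m l *\<^sub>v \<phi> i) =
      (mat_adjoint S *\<^sub>v z) \<bullet>c vec d (\<lambda>k. \<mu> k ^ l * ?\<psi> $ k)"
    using cscalar_prod_mult_mat_vec[OF S z, of "vec d (\<lambda>k. \<mu> k ^ l * ?\<psi> $ k)"] by simp
  also have "\<dots> = (\<Sum>k<d. (mat_adjoint S *\<^sub>v z) $ k * cnj (?\<psi> $ k) * cnj (\<mu> k) ^ l)"
    by (auto simp: scalar_prod_def lessThan_atLeast0 mult_ac intro!: sum.cong)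
  also have "\<dots> = (\<Sum>k\<in>supp ?\<psi>. (mat_adjoint S *\<^sub>v z) $ k * cnj (?\<psi> $ k) * cnj (\<mu> k) ^ l)"
    using \<psi> Sinv by (intro sum.mono_neutral_right) (auto simp: supp_def)
  finally show ?thesis by (simp add: st_sample_def)
qed

text \<open>Injectivity of the adjoint, without inverting it: entry \<open>i\<close> of a vector is
  recovered by pairing with the \<open>v\<close> for which \<open>S *\<^sub>v v\<close> is the unit
  vector.\<close>

lemma adjoint_image_proportional:
  fixes S Sinv :: "complex mat"
  assumes S: "S \<in> carrier_mat d d" and Sinv: "Sinv \<in> carrier_mat d d" and inv: "S * Sinv = 1\<^sub>m d"
    and x: "x \<in> carrier_vec d" and z: "z \<in> carrier_vec d"
    and eq: "\<And>k. k < d \<Longrightarrow> (mat_adjoint S *\<^sub>v z) $ k = e * (mat_adjoint S *\<^sub>v x) $ k"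
  shows "z = e \<cdot>\<^sub>v x"
proof (rule eq_vecI)
  fix i assume "i < dim_vec (e \<cdot>\<^sub>v x)"
  then have i: "i < d" using x by simp
  define v where "v = Sinv *\<^sub>v unit_vec d i"
  have v: "v \<in> carrier_vec d" using Sinv by (simp add: v_def)
  have Sv: "S *\<^sub>v v = unit_vec d i"
    unfolding v_def using inv S Sinv by (simp flip: assoc_mult_mat_vec)
  have entry: "u $ i = (\<Sum>k<d. (mat_adjoint S *\<^sub>v u) $ k * cnj (v $ k))" if u: "u \<in> carrier_vec d" for u
  proof -
    have "conjugate (unit_vec d i) = (unit_vec d i :: complex vec)"
      by (intro eq_vecI) (auto simp: unit_vec_def)
    then have "u $ i = u \<bullet>c (S *\<^sub>v v)"
      using u i unfolding Sv by simp
    then show ?thesis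
      using cscalar_prod_mult_mat_vec[OF S u v] v by (simp add: scalar_prod_def lessThan_atLeast0)
  qed
  show "z $ i = (e \<cdot>\<^sub>v x) $ i"
    using i x entry[OF x] entry[OF z] eq by (simp add: sum_distrib_left mult_ac)
qed (use x z in simp)

text \<open>As \<open>L\<close> bounds every support, \<open>2 * L\<^sup>2\<close> powers are enough
  moments for each sampling vector at once.\<close>

lemma identifiable_from_grid:
  fixes S Sinv :: "complex mat"
  assumes S: "S \<in> carrier_mat d d" and Sinv: "Sinv \<in> carrier_mat d d"
    and inv: "S * Sinv = 1\<^sub>m d" "Sinv * S = 1\<^sub>m d"
    and \<phi>: "\<And>i. i < J \<Longrightarrow> \<phi> i \<in> carrier_vec d" and ai: "allows_identification d Sinv J \<phi>"
    and L: "\<And>i. i < J \<Longrightarrow> card (supp (Sinv *\<^sub>v \<phi> i)) \<le> L"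
    and acf: "absolutely_collision_free d \<Lambda>" and x: "x \<in> carrier_vec d"
    and y: "\<And>k. k < d \<Longrightarrow> (mat_adjoint S *\<^sub>v x) $ k \<noteq> 0"
  shows "identifiable_from d S Sinv \<phi> ({..<J} \<times> {..<2 * L\<^sup>2}) \<Lambda> x"
  unfolding identifiable_from_def
proof (intro allI impI)
  fix \<mu> z
  assume z: "z \<in> carrier_vec d"
    and eq: "\<forall>\<omega>\<in>{..<J} \<times> {..<2 * L\<^sup>2}. st_sample (S * mat_diag d \<mu> * Sinv) \<phi> z \<omega> =
      st_sample (S * mat_diag d \<Lambda> * Sinv) \<phi> x \<omega>"
  define \<psi> where "\<psi> = (\<lambda>i. Sinv *\<^sub>v \<phi> i)"
  have conds: "index_separation d J \<psi>" "phase_propagation J \<psi>" "winding_direction d J \<psi>"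
    using ai by (simp_all add: allows_identification_def \<psi>_def)
  have dim: "dim_vec (\<psi> i) = d" if "i < J" for i using Sinv by (simp add: \<psi>_def)
  have card: "2 * (card (supp (\<psi> i)))\<^sup>2 \<le> 2 * L\<^sup>2" if "i < J" for i
    using L[OF that] by (simp add: \<psi>_def power_mono)
  have samples: "cmod (\<Sum>k\<in>supp (\<psi> i). (mat_adjoint S *\<^sub>v z) $ k * cnj (\<psi> i $ k) * cnj (\<mu> k) ^ l) =
      cmod (\<Sum>k\<in>supp (\<psi> i). (mat_adjoint S *\<^sub>v x) $ k * cnj (\<psi> i $ k) * cnj (\<Lambda> k) ^ l)"
    if "i < J" "l < 2 * L\<^sup>2" for i l
    using eq that st_sample_diagonalized[where \<phi> = \<phi>, OF S Sinv inv \<phi>[OF that(1)] z, of \<mu> l]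
      st_sample_diagonalized[where \<phi> = \<phi>, OF S Sinv inv \<phi>[OF that(1)] x, of \<Lambda> l]
    by (auto simp: \<psi>_def)
  note id = spectrum_and_signal_identification[where y = "\<lambda>k. (mat_adjoint S *\<^sub>v x) $ k"
      and w = "\<lambda>k. (mat_adjoint S *\<^sub>v z) $ k", OF acf conds dim y card samples]
  obtain e where "cmod e = 1" "\<And>k. k < d \<Longrightarrow> (mat_adjoint S *\<^sub>v z) $ k = e * (mat_adjoint S *\<^sub>v x) $ k"
    using id(2) by blast
  then have "\<exists>c. cmod c = 1 \<and> z = c \<cdot>\<^sub>v x"
    using adjoint_image_proportional[OF S Sinv inv(1) x z] by blast
  then show "(\<exists>c. cmod c = 1 \<and> (\<forall>j<d. \<mu> j = c * \<Lambda> j)) \<and> (\<exists>c. cmod c = 1 \<and> z = c \<cdot>\<^sub>v x)"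
    using id(1) by blast
qed

subsection \<open>Sliding windows\<close>

text \<open>The imaginary entry makes the relative phase of the components 1 and 2 differ between
  the windows 0 and 1.\<close>

definition window_vec :: "nat \<Rightarrow> nat \<Rightarrow> nat \<Rightarrow> complex vec" where
  "window_vec d L i = vec d (\<lambda>k. if i \<le> k \<and> k < i + L then (if i = 1 \<and> k = 1 then \<i> else 1) else 0)"

lemma supp_window_vec:
  assumes "i + L \<le> d"
  shows "supp (window_vec d L i) = {i..<i + L}"
  using assms by (auto simp: supp_def window_vec_def split: if_splits)

text \<open>Near the left end, \<open>k\<close> is the window starting at \<open>k\<close> minus the
  next one; near the right end, the window ending at \<open>k\<close> minus the previous one; in
  between, the first and last windows containing \<open>k\<close> meet only there. The bound on
  \<open>d\<close> makes all these windows available.\<close>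

lemma index_separation_windows:
  assumes L: "1 \<le> L" "2 * L - 1 \<le> d"
    and supp: "\<And>i. i < d - L + 1 \<Longrightarrow> supp (\<psi> i) = {i..<i + L}"
  shows "index_separation d (d - L + 1) \<psi>"
  unfolding index_separation_def
proof (intro conjI allI impI)
  show "(\<Union>i<d - L + 1. supp (\<psi> i)) = {..<d}"
  proof (intro equalityI subsetI)
    fix k assume "k \<in> {..<d}"
    then have "min k (d - L) < d - L + 1" "k \<in> {min k (d - L)..<min k (d - L) + L}"
      using L by auto
    then show "k \<in> (\<Union>i<d - L + 1. supp (\<psi> i))" using supp by blast
  qed (use supp L in auto)
next
  fix k assume k: "k < d"
  consider "k < L - 1" | "L - 1 \<le> k" "k \<le> d - L" | "d - L < k" by linarith
  then show "\<exists>F G. F \<subseteq> {..<d - L + 1} \<and> G \<subseteq> {..<d - L + 1} \<and>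
      {k} = (\<Inter>i\<in>F. supp (\<psi> i)) - (\<Union>i\<in>G. supp (\<psi> i))"
  proof cases
    case 1
    then show ?thesis using L k by (intro exI[of _ "{k}"] exI[of _ "{k + 1}"]) (auto simp: supp)
  next
    case 2
    then show ?thesis using L k
      by (intro exI[of _ "{k, k + 1 - L}"] exI[of _ "{}"]) (auto simp: supp)
  next
    case 3
    then show ?thesis using L k
      by (intro exI[of _ "{k + 1 - L}"] exI[of _ "{k - L}"]) (auto simp: supp)
  qed
qed

text \<open>Neighbouring windows share \<open>L - 1\<close> indices, which is at least two exactly
  when \<open>3 \<le> L\<close>.\<close>

lemma phase_propagation_windows:
  assumes L: "3 \<le> L" and supp: "\<And>i. i < J \<Longrightarrow> supp (\<psi> i) = {i..<i + L}"
  shows "phase_propagation J \<psi>"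
  unfolding phase_propagation_def
proof (intro allI impI)
  fix k assume k: "1 \<le> k \<and> k < J"
  then have "{k, k + 1} \<subseteq> supp (\<psi> k) \<inter> supp (\<psi> (k - 1))"
    using L by (auto simp: supp)
  also have "\<dots> \<subseteq> supp (\<psi> k) \<inter> (\<Union>i<k. supp (\<psi> i))"
    using k by (intro Int_mono order_refl UN_upper) auto
  finally have "card {k, k + 1} \<le> card (supp (\<psi> k) \<inter> (\<Union>i<k. supp (\<psi> i)))"
    using k supp by (intro card_mono) auto
  then show "2 \<le> card (supp (\<psi> k) \<inter> (\<Union>i<k. supp (\<psi> i)))" by simp
qed

lemma winding_direction_windows:
  assumes "3 \<le> L" "2 \<le> J" "2 < d"
  shows "winding_direction d J (window_vec d L)"
proof -
  \<comment> \<open>At components 1 and 2 the conjugate product is \<open>1\<close> in window 0 and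
    \<open>\<i>\<close> in window 1, with arguments 0 and \<open>pi / 2\<close>.\<close>
  have "pi / 2 rmod pi = pi / 2" by (rule rmod_idem) auto
  moreover have "Arg 1 = 0" by (rule cis_Arg_unique) auto
  ultimately have "\<not> [Arg 1 = Arg \<i>] (rmod pi)" by (simp add: rcong_def)
  then show ?thesis
    unfolding winding_direction_def
    using assms
    by (intro exI[of _ "0::nat"] exI[of _ "1::nat"] exI[of _ "2::nat"] conjI)
      (auto simp: window_vec_def)
qed

theorem corollary7p3:
  fixes d :: nat and S Sinv :: "complex mat"
  assumes "S \<in> carrier_mat d d" and "Sinv \<in> carrier_mat d d"
    and "S * Sinv = 1\<^sub>m d" and "Sinv * S = 1\<^sub>m d"
  shows
    "(\<forall>J \<phi>. (\<forall>i<J. \<phi> i \<in> carrier_vec d) \<and> allows_identification d Sinv J \<phi> \<longrightarrow>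
        (\<exists>\<Omega>. \<Omega> \<subseteq> {..<J} \<times> UNIV \<and> finite \<Omega> \<and>
             card \<Omega> \<le> 2 * (max_sparsity Sinv J \<phi>)^2 * J \<and>
             (\<forall>\<Lambda> x. absolutely_collision_free d \<Lambda> \<and> x \<in> carrier_vec d \<and>
                     (\<forall>k<d. (mat_adjoint S *\<^sub>v x) $ k \<noteq> 0) \<longrightarrow>
                identifiable_from d S Sinv \<phi> \<Omega> \<Lambda> x)))
     \<and>
     (\<forall>L. 3 \<le> L \<and> 2 * L - 1 \<le> d \<longrightarrow>
        (\<exists>\<phi> \<Omega>. (\<forall>i \<le> d - L. \<phi> i \<in> carrier_vec d \<and> supp (Sinv *\<^sub>v \<phi> i) = {i..<i + L}) \<and>
             allows_identification d Sinv (d - L + 1) \<phi> \<and>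
             \<Omega> \<subseteq> {..<d - L + 1} \<times> UNIV \<and> finite \<Omega> \<and> card \<Omega> \<le> 2 * L^2 * d \<and>
             (\<forall>\<Lambda> x. absolutely_collision_free d \<Lambda> \<and> x \<in> carrier_vec d \<and>
                     (\<forall>k<d. (mat_adjoint S *\<^sub>v x) $ k \<noteq> 0) \<longrightarrow>
                identifiable_from d S Sinv \<phi> \<Omega> \<Lambda> x)))"
proof (intro conjI allI impI)
  note S = assms(1) and Sinv = assms(2) and inv = assms(3,4)
  fix J :: nat and \<phi> :: "nat \<Rightarrow> complex vec"
  assume asm: "(\<forall>i<J. \<phi> i \<in> carrier_vec d) \<and> allows_identification d Sinv J \<phi>"
  let ?L = "max_sparsity Sinv J \<phi>"
  have L: "card (supp (Sinv *\<^sub>v \<phi> i)) \<le> ?L" if "i < J" for i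
    unfolding max_sparsity_def using that by (intro Max_ge) auto
  show "\<exists>\<Omega>. \<Omega> \<subseteq> {..<J} \<times> UNIV \<and> finite \<Omega> \<and> card \<Omega> \<le> 2 * ?L\<^sup>2 * J \<and>
      (\<forall>\<Lambda> x. absolutely_collision_free d \<Lambda> \<and> x \<in> carrier_vec d \<and>
          (\<forall>k<d. (mat_adjoint S *\<^sub>v x) $ k \<noteq> 0) \<longrightarrow> identifiable_from d S Sinv \<phi> \<Omega> \<Lambda> x)"
  proof (intro exI[of _ "{..<J} \<times> {..<2 * ?L\<^sup>2}"] conjI allI impI)
    fix \<Lambda> x
    assume "absolutely_collision_free d \<Lambda> \<and> x \<in> carrier_vec d \<and> (\<forall>k<d. (mat_adjoint S *\<^sub>v x) $ k \<noteq> 0)"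
    then show "identifiable_from d S Sinv \<phi> ({..<J} \<times> {..<2 * ?L\<^sup>2}) \<Lambda> x"
      using asm by (intro identifiable_from_grid[OF S Sinv inv _ _ L]) auto
  qed (auto simp: card_cartesian_product)
next
  note S = assms(1) and Sinv = assms(2) and inv = assms(3,4)
  fix L :: nat
  assume asm: "3 \<le> L \<and> 2 * L - 1 \<le> d"
  define J where "J = d - L + 1"
  \<comment> \<open>Applying \<open>S\<close> to the windows makes the coefficient vectors exactly
    the windows.\<close>
  define \<phi> where "\<phi> = (\<lambda>i. S *\<^sub>v window_vec d L i)"
  let ?\<Omega> = "{..<J} \<times> {..<2 * L\<^sup>2}"
  have w: "window_vec d L i \<in> carrier_vec d" for i by (simp add: window_vec_def)
  have \<phi>: "\<phi> i \<in> carrier_vec d" for i using S w by (simp add: \<phi>_def)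
  have \<psi>: "Sinv *\<^sub>v \<phi> i = window_vec d L i" for i
    unfolding \<phi>_def using inv S Sinv w by (simp flip: assoc_mult_mat_vec)
  have supp: "supp (window_vec d L i) = {i..<i + L}" if "i < J" for i
    using that asm by (intro supp_window_vec) (auto simp: J_def)
  have ai: "allows_identification d Sinv J \<phi>"
    unfolding allows_identification_def \<psi>
    using asm supp index_separation_windows[of L d "window_vec d L"]
      phase_propagation_windows[of L J "window_vec d L"] winding_direction_windows[of L J d]
    by (auto simp: J_def)
  have "identifiable_from d S Sinv \<phi> ?\<Omega> \<Lambda> x"
    if "absolutely_collision_free d \<Lambda> \<and> x \<in> carrier_vec d \<and> (\<forall>k<d. (mat_adjoint S *\<^sub>v x) $ k \<noteq> 0)" for \<Lambda> x
    using that by (intro identifiable_from_grid[OF S Sinv inv \<phi> ai]) (auto simp: \<psi> supp)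
  moreover have "J \<le> d" using asm unfolding J_def by linarith
  then have "card ?\<Omega> \<le> 2 * L\<^sup>2 * d"
    by (simp add: card_cartesian_product)
  ultimately show "\<exists>\<phi> \<Omega>. (\<forall>i \<le> d - L. \<phi> i \<in> carrier_vec d \<and> supp (Sinv *\<^sub>v \<phi> i) = {i..<i + L}) \<and>
      allows_identification d Sinv (d - L + 1) \<phi> \<and>
      \<Omega> \<subseteq> {..<d - L + 1} \<times> UNIV \<and> finite \<Omega> \<and> card \<Omega> \<le> 2 * L\<^sup>2 * d \<and>
      (\<forall>\<Lambda> x. absolutely_collision_free d \<Lambda> \<and> x \<in> carrier_vec d \<and>
          (\<forall>k<d. (mat_adjoint S *\<^sub>v x) $ k \<noteq> 0) \<longrightarrow> identifiable_from d S Sinv \<phi> \<Omega> \<Lambda> x)"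
    using \<phi> \<psi> supp ai unfolding J_def[symmetric]
    by (intro exI[of _ \<phi>] exI[of _ ?\<Omega>]) (auto simp: J_def less_Suc_eq_le)
qed

end
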